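(* The symmetrized Riley polynomial of any 2-bridge kmot group is unimodal. That is, for every $n\ge1$ and every symmetric sequence $\epsilon=(\epsilon_1,\dots,\epsilon_{2n})$ with $\epsilon_i\in\{1,-1\}$ and $\epsilon_i=\epsilon_{2n+1-i}$, the polynomial $\phi^\epsilon_{2n}(x)$ determined by $\phi^\epsilon_{2n}(x^2)=x^{2n}s^\epsilon_{2n+1}\bigl(x+\frac1x\bigr)$ is unimodal.
   Context: For a sequence of signs $\epsilon=(\epsilon_1,\epsilon_2,\dots)$, $s^\epsilon_n(u)$ is defined by $s^\epsilon_0=0$, $s^\epsilon_1=1$, $s^\epsilon_{k+1}(u)=\epsilon_k u\,s^\epsilon_k(u)-s^\epsilon_{k-1}(u)$ for $k\ge1$. A 2-bridge kmot group is $G(\epsilon)=\langle x,y\mid wx=yw\rangle$, $w=x^{\epsilon_1}y^{\epsilon_2}\cdots x^{\epsilon_{2n-1}}y^{\epsilon_{2n}}$, for a symmetric sign sequence $\epsilon$ of length $2n$; its Riley polynomial $\mathcal R$ satisfies $\mathcal R(-u^2)=(-1)^ns^\epsilon_{2n+1}(u)$, and its symmetrized Riley polynomial is the polynomial $\phi^\epsilon_{2n}(x)$ with $\phi^\epsilon_{2n}(x^2)=x^{2n}s^\epsilon_{2n+1}(x+\frac1x)$ (which exists since $s^\epsilon_{2n+1}$ is an even polynomial of degree $2n$). A polynomial $\sum_{i=0}^N a_ix^i\in\mathbb R[x]$ is unimodal if there is an index $0\le j\le N$ such that either $a_0\le a_1\le\cdots\le a_j\ge a_{j+1}\ge\cdots\ge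 a_N$, or $a_0\ge a_1\ge\cdots\ge a_j\le a_{j+1}\le\cdots\le a_N$. *)

theory Defs
  imports Complex_Main "HOL-Computational_Algebra.Polynomial"
begin

definition symmetric_signs :: "nat \<Rightarrow> (nat \<Rightarrow> real) \<Rightarrow> bool" where
  "symmetric_signs n \<epsilon> \<longleftrightarrow>
     (\<forall>i\<in>{1..2 * n}. \<epsilon> i \<in> {1, -1} \<and> \<epsilon> i = \<epsilon> (2 * n + 1 - i))"

(* Only the values of \<epsilon> at indices i \<ge> 1 are used; \<open>s_poly \<epsilon> k\<close> depends on
   \<epsilon> 1, ..., \<epsilon> (k - 1). *)
fun s_poly :: "(nat \<Rightarrow> real) \<Rightarrow> nat \<Rightarrow> real poly" where
  "s_poly \<epsilon> 0 = 0"
| "s_poly \<epsilon> (Suc 0) = 1"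
| "s_poly \<epsilon> (Suc (Suc k)) =
     smult (\<epsilon> (Suc k)) ([:0, 1:] * s_poly \<epsilon> (Suc k)) - s_poly \<epsilon> k"

(* Division by zero is total in HOL, hence the guard x \<noteq> 0. *)
definition is_symmetrized_Riley :: "nat \<Rightarrow> (nat \<Rightarrow> real) \<Rightarrow> real poly \<Rightarrow> bool" where
  "is_symmetrized_Riley n \<epsilon> p \<longleftrightarrow>
     (\<forall>x. x \<noteq> 0 \<longrightarrow>
        poly p (x\<^sup>2) = x ^ (2 * n) * poly (s_poly \<epsilon> (2 * n + 1)) (x + 1 / x))"

definition symmetrized_Riley :: "nat \<Rightarrow> (nat \<Rightarrow> real) \<Rightarrow> real poly" where
  "symmetrized_Riley n \<epsilon> = (THE p. is_symmetrized_Riley n \<epsilon> p)"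

(* The last index is the degree, i.e. no zero coefficients are appended at the top. *)
definition unimodal :: "real poly \<Rightarrow> bool" where
  "unimodal p \<longleftrightarrow> (\<exists>j\<le>degree p.
     mono_on {0..j} (coeff p) \<and> antimono_on {j..degree p} (coeff p) \<or>
     antimono_on {0..j} (coeff p) \<and> mono_on {j..degree p} (coeff p))"

lemma ex_homogenized_s_poly:
  "\<exists>p. \<forall>x. x \<noteq> 0 \<longrightarrow> poly p (x\<^sup>2) = x ^ k * poly (s_poly \<epsilon> (Suc k)) (x + 1 / x)"
proof (induction k rule: less_induct)
  case (less k)
  consider "k = 0" | "k = 1" | m where "k = Suc (Suc m)"
    by (metis One_nat_def not0_implies_Suc)
  then show ?case
  proof cases
    case 1
    then show ?thesis by (intro exI[of _ 1]) simp
  next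
    case 2
    then show ?thesis
      by (intro exI[of _ "[:\<epsilon> 1, \<epsilon> 1:]"]) (auto simp: field_simps power2_eq_square)
  next
    case (3 m)
    obtain p where p: "\<And>x. x \<noteq> 0 \<Longrightarrow>
        poly p (x\<^sup>2) = x ^ Suc m * poly (s_poly \<epsilon> (Suc (Suc m))) (x + 1 / x)"
      using less[of "Suc m"] 3 by auto
    obtain q where q: "\<And>x. x \<noteq> 0 \<Longrightarrow>
        poly q (x\<^sup>2) = x ^ m * poly (s_poly \<epsilon> (Suc m)) (x + 1 / x)"
      using less[of m] 3 by auto
    have "poly (smult (\<epsilon> k) ([:1, 1:] * p) - [:0, 1:] * q) (x\<^sup>2)
        = x ^ k * poly (s_poly \<epsilon> (Suc k)) (x + 1 / x)" if x: "x \<noteq> 0" for x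
    proof -
      have e: "x\<^sup>2 + 1 = x * (x + 1 / x)"
        using x by (simp add: field_simps power2_eq_square)
      have "poly (smult (\<epsilon> k) ([:1, 1:] * p) - [:0, 1:] * q) (x\<^sup>2)
          = \<epsilon> k * ((x\<^sup>2 + 1) * poly p (x\<^sup>2)) - x\<^sup>2 * poly q (x\<^sup>2)"
        by (simp add: algebra_simps)
      also have "\<dots> = x ^ k * (\<epsilon> k * ((x + 1 / x) * poly (s_poly \<epsilon> (Suc (Suc m))) (x + 1 / x))
            - poly (s_poly \<epsilon> (Suc m)) (x + 1 / x))"
        unfolding p[OF x] q[OF x] e 3
        by (simp only: power_Suc power2_eq_square right_diff_distrib mult_ac)
      also have "\<dots> = x ^ k * poly (s_poly \<epsilon> (Suc k)) (x + 1 / x)"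
        unfolding 3 s_poly.simps(3)[of \<epsilon> "Suc m"]
        by (simp del: s_poly.simps)
      finally show ?thesis .
    qed
    then show ?thesis by blast
  qed
qed

lemma ex1_symmetrized_Riley: "\<exists>!p. is_symmetrized_Riley n \<epsilon> p"
proof (rule ex_ex1I)
  show "\<exists>p. is_symmetrized_Riley n \<epsilon> p"
    using ex_homogenized_s_poly[of "2 * n" \<epsilon>] by (simp add: is_symmetrized_Riley_def)
next
  fix p q
  assume pq: "is_symmetrized_Riley n \<epsilon> p" "is_symmetrized_Riley n \<epsilon> q"
  have "poly (p - q) y = 0" if "y \<in> {0<..<1}" for y
    using pq[unfolded is_symmetrized_Riley_def, rule_format, of "sqrt y"] that by simp
  then have "{0<..<1 :: real} \<subseteq> {y. poly (p - q) y = 0}" by blast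
  then have "infinite {y. poly (p - q) y = 0}"
    by (rule infinite_super) (simp add: infinite_Ioo)
  then show "p = q" using poly_roots_finite[of "p - q"] by auto
qed

lemma symmetrized_Riley: "is_symmetrized_Riley n \<epsilon> (symmetrized_Riley n \<epsilon>)"
  unfolding symmetrized_Riley_def by (rule theI') (rule ex1_symmetrized_Riley)

end

theory Submission imports Defs begin

text \<open>
  Multiplying \<open>s\<^sub>k\<close> by \<open>\<epsilon>\<^sub>1 \<dots> \<epsilon>\<^sub>k\<^sub>-\<^sub>1\<close> turns the recursion into
  \<open>p\<^sub>k\<^sub>+\<^sub>1 = u p\<^sub>k - \<delta>\<^sub>k p\<^sub>k\<^sub>-\<^sub>1\<close> with \<open>\<delta>\<^sub>k = \<epsilon>\<^sub>k \<epsilon>\<^sub>k\<^sub>-\<^sub>1 = \<plusminus>1\<close>. Let \<open>U\<^sub>m\<close> be the Chebyshev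
  polynomials with \<open>U\<^sub>m (x + 1/x) = x\<^sup>m + x\<^sup>m\<^sup>-\<^sup>2 + \<dots> + x\<^sup>-\<^sup>m\<close>. Their nonnegative
  combinations are closed under multiplication, because
  \<open>U\<^sub>m\<^sub>+\<^sub>1 U\<^sub>j\<^sub>+\<^sub>1 = U\<^sub>m\<^sub>+\<^sub>j\<^sub>+\<^sub>2 + U\<^sub>m U\<^sub>j\<close>. Since
  \<open>U\<^sub>m\<^sub>+\<^sub>1 p\<^sub>k\<^sub>+\<^sub>1 - U\<^sub>m p\<^sub>k = U\<^sub>m\<^sub>+\<^sub>2 p\<^sub>k - \<delta>\<^sub>k U\<^sub>m\<^sub>+\<^sub>1 p\<^sub>k\<^sub>-\<^sub>1\<close>, one sees by induction on \<open>k\<close> that \<open>p\<^sub>k\<close>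
  and all \<open>U\<^sub>m\<^sub>+\<^sub>1 p\<^sub>k \<plusminus> U\<^sub>m p\<^sub>k\<^sub>-\<^sub>1\<close> are such combinations. After the substitution \<open>u = x + 1/x\<close>
  each \<open>U\<^sub>m\<close> is a block of ones with the same centre, so their nonnegative combinations are unimodal.
\<close>

text \<open>With \<open>U_m\<close> as above, this is \<open>x^m U_m(x + 1/x)\<close> written as a
  polynomial in \<open>x^2\<close>.\<close>

definition geom_poly :: "nat \<Rightarrow> real poly" where
  "geom_poly m = (\<Sum>i\<le>m. monom 1 i)"

lemma geom_poly_0 [simp]: "geom_poly 0 = 1"
  by (simp add: geom_poly_def)

lemma geom_poly_Suc: "geom_poly (Suc m) = geom_poly m + monom 1 (Suc m)"
  by (simp add: geom_poly_def)

lemma coeff_geom_poly: "coeff (geom_poly m) k = (if k \<le> m then 1 else 0)"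
  by (simp add: geom_poly_def coeff_sum)

lemma geom_poly_Suc_0: "geom_poly (Suc 0) = [:1, 1:]"
  by (simp add: geom_poly_Suc monom_Suc one_pCons)

lemma geom_poly_add_Suc:
  "geom_poly (Suc (m + j)) = geom_poly m + monom 1 (Suc m) * geom_poly j"
  by (induction j) (simp_all add: geom_poly_Suc algebra_simps mult_monom)

lemma geom_poly_Suc_left: "geom_poly (Suc m) = 1 + monom 1 1 * geom_poly m"
  using geom_poly_add_Suc[of 0 m] by simp

lemma geom_poly_mult_Suc:
  "geom_poly (Suc m) * geom_poly (Suc j) =
     geom_poly (Suc (Suc (m + j))) + monom 1 1 * (geom_poly m * geom_poly j)"
proof -
  have "geom_poly (Suc m) * geom_poly (Suc j)
      = geom_poly (Suc m) + monom 1 1 * ((geom_poly m + monom 1 (Suc m)) * geom_poly j)"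
    by (subst geom_poly_Suc_left[of j]) (simp add: geom_poly_Suc algebra_simps)
  also have "\<dots> = geom_poly (Suc m) + monom 1 (Suc (Suc m)) * geom_poly j
      + monom 1 1 * (geom_poly m * geom_poly j)"
    by (simp add: distrib_left distrib_right mult_monom add_ac flip: mult.assoc)
  also have "\<dots> = geom_poly (Suc (Suc (m + j))) + monom 1 1 * (geom_poly m * geom_poly j)"
    using geom_poly_add_Suc[of "Suc m" j] by simp
  finally show ?thesis .
qed

lemma geom_poly_recurrence:
  "[:1, 1:] * geom_poly (Suc m) - monom 1 1 * geom_poly m = geom_poly (Suc (Suc m))"
  using geom_poly_mult_Suc[of 0 m] by (simp add: geom_poly_Suc_0)

text \<open>\<open>d\<close> is twice the common centre of the blocks:
  \<open>monom 1 i * geom_poly m\<close> occupies the exponents \<open>i\<close> to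
  \<open>i + m\<close>.\<close>

inductive geom_cone :: "nat \<Rightarrow> real poly \<Rightarrow> bool" where
  zero: "geom_cone d 0"
| add: "geom_cone d p \<Longrightarrow> geom_cone d q \<Longrightarrow> geom_cone d (p + q)"
| block: "geom_cone (m + 2 * i) (monom 1 i * geom_poly m)"

lemma geom_cone_geom_poly: "geom_cone m (geom_poly m)"
  using geom_cone.block[of m 0] by simp

lemma geom_cone_shift: "geom_cone d p \<Longrightarrow> geom_cone (Suc (Suc d)) (monom 1 1 * p)"
proof (induction rule: geom_cone.induct)
  case (block m i)
  show ?case
    using geom_cone.block[of m "Suc i"] by (simp add: mult_monom flip: mult.assoc)
qed (auto simp: distrib_left intro: geom_cone.intros)

lemma geom_cone_shift_iter: "geom_cone d p \<Longrightarrow> geom_cone (d + 2 * i) (monom 1 i * p)"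
proof (induction i)
  case (Suc i)
  then show ?case
    using geom_cone_shift[of "d + 2 * i" "monom 1 i * p"] by (simp add: mult_monom flip: mult.assoc)
qed simp

lemma geom_cone_geom_poly_mult: "geom_cone (m + j) (geom_poly m * geom_poly j)"
proof (induction m arbitrary: j)
  case (Suc m)
  show ?case
  proof (cases j)
    case (Suc j')
    then show ?thesis
      using geom_cone.add[OF geom_cone_geom_poly geom_cone_shift[OF Suc.IH[of j']]]
      by (simp add: geom_poly_mult_Suc)
  qed (simp add: geom_cone_geom_poly)
qed (simp add: geom_cone_geom_poly)

lemma geom_cone_mult: "geom_cone d p \<Longrightarrow> geom_cone (m + d) (geom_poly m * p)"
proof (induction rule: geom_cone.induct)
  case (block j i)
  show ?case
    using geom_cone_shift_iter[OF geom_cone_geom_poly_mult[of m j], of i]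
    by (simp add: add.assoc mult.left_commute)
qed (auto simp: distrib_left intro: geom_cone.intros)

text \<open>A block centred at \<open>d/2\<close> that contains \<open>k\<close> reaches at least
  its centre, so it contains \<open>l\<close> too.\<close>

lemma geom_cone_coeff_mono:
  assumes "geom_cone d p" "k \<le> l" "2 * l \<le> d"
  shows "coeff p k \<le> coeff p l"
  using assms
  by (induction rule: geom_cone.induct)
     (auto simp: coeff_monom_mult coeff_geom_poly intro: add_mono)

lemma geom_cone_coeff_antimono:
  assumes "geom_cone d p" "k \<le> l" "d \<le> 2 * k"
  shows "coeff p l \<le> coeff p k"
  using assms
  by (induction rule: geom_cone.induct)
     (auto simp: coeff_monom_mult coeff_geom_poly intro: add_mono)

lemma unimodal_geom_cone:
  assumes "geom_cone (2 * n) p"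
  shows "unimodal p"
proof -
  \<comment> \<open>The centre is \<open>n\<close>, but \<open>unimodal\<close> asks for a turning
    index within the degree.\<close>
  let ?j = "min n (degree p)"
  have "mono_on {0..?j} (coeff p)"
    by (auto intro!: mono_onI geom_cone_coeff_mono[OF assms])
  moreover have "antimono_on {?j..degree p} (coeff p)"
    by (cases "n \<le> degree p")
       (auto intro!: monotone_onI geom_cone_coeff_antimono[OF assms])
  ultimately show ?thesis
    unfolding unimodal_def by (intro exI[of _ ?j]) auto
qed

text \<open>Negation swaps the two alternatives of \<open>unimodal\<close>; this handles a global
  sign -1.\<close>

lemma unimodal_uminus:
  assumes "unimodal p"
  shows "unimodal (- p)"
  using assms unfolding unimodal_def monotone_on_def by simp blast

text \<open>The polynomial \<open>p\<^sub>k\<^sub>+\<^sub>1\<close> above, in the form \<open>x\<^sup>k p\<^sub>k\<^sub>+\<^sub>1 (x + 1/x)\<close> and as a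
  polynomial in \<open>x\<^sup>2\<close>; \<open>\<delta>\<close> is reindexed to start at \<open>0\<close>.\<close>

fun cont_poly :: "(nat \<Rightarrow> real) \<Rightarrow> nat \<Rightarrow> real poly" where
  "cont_poly \<delta> 0 = 1"
| "cont_poly \<delta> (Suc 0) = [:1, 1:]"
| "cont_poly \<delta> (Suc (Suc k)) =
     [:1, 1:] * cont_poly \<delta> (Suc k) - smult (\<delta> k) (monom 1 1 * cont_poly \<delta> k)"

lemma geom_cone_cont_poly:
  assumes "\<And>i. Suc i < k \<Longrightarrow> \<delta> i \<in> {1, -1}"
  shows "geom_cone k (cont_poly \<delta> k)"
proof -
  let ?q = "cont_poly \<delta>"
  let ?A = "\<lambda>m k. geom_poly (Suc m) * ?q (Suc k)"
  let ?B = "\<lambda>m k. monom 1 1 * (geom_poly m * ?q k)"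
  have "geom_cone j (?q j) \<and> geom_cone (Suc j) (?q (Suc j)) \<and>
      (\<forall>m. geom_cone (Suc (Suc (m + j))) (?A m j - ?B m j) \<and>
           geom_cone (Suc (Suc (m + j))) (?A m j + ?B m j))"
    if "\<And>i. i < j \<Longrightarrow> \<delta> i \<in> {1, -1}" for j
    using that
  proof (induction j)
    case 0
    have *: "?A m 0 - ?B m 0 = geom_poly (Suc (Suc m))" for m
      using geom_poly_recurrence[of m] by (simp add: mult.commute)
    have "?A m 0 + ?B m 0 = geom_poly (Suc (Suc m)) + (?B m 0 + ?B m 0)" for m
      unfolding *[symmetric] by simp
    moreover have "geom_cone (Suc (Suc m)) (?B m 0)" for m
      using geom_cone_shift[OF geom_cone_geom_poly] by simp
    ultimately have "geom_cone (Suc (Suc m)) (?A m 0 + ?B m 0)" for m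
      using geom_cone.add geom_cone_geom_poly by metis
    then show ?case
      using * geom_cone_geom_poly[of 0] geom_cone_geom_poly[of "Suc 0"] geom_cone_geom_poly
      by (metis add_0_right cont_poly.simps(1,2) geom_poly_0 geom_poly_Suc_0)
  next
    case (Suc j)
    then have IH: "geom_cone (Suc j) (?q (Suc j))"
        "\<And>m. geom_cone (Suc (Suc (m + j))) (?A m j - ?B m j)"
        "\<And>m. geom_cone (Suc (Suc (m + j))) (?A m j + ?B m j)"
      and \<delta>: "\<delta> j \<in> {1, -1}"
      by auto
    have step: "geom_cone (Suc (Suc (m + j))) (?A m j - smult (\<delta> j) (?B m j))" for m
      using \<delta> IH(2,3)[of m] by auto
    have minus_eq: "?A m (Suc j) - ?B m (Suc j) = ?A (Suc m) j - smult (\<delta> j) (?B (Suc m) j)" for m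
      unfolding geom_poly_recurrence[of m, symmetric] by (simp add: algebra_simps)
    have minus: "geom_cone (Suc (Suc (m + Suc j))) (?A m (Suc j) - ?B m (Suc j))" for m
      unfolding minus_eq using step[of "Suc m"] by simp
    have B: "geom_cone (Suc (Suc (m + Suc j))) (?B m (Suc j))" for m
      using geom_cone_shift[OF geom_cone_mult[OF IH(1)]] by simp
    \<comment> \<open>The sum follows from the difference because \<open>?B\<close> itself lies in
      the cone.\<close>
    have "?A m (Suc j) + ?B m (Suc j)
        = (?A m (Suc j) - ?B m (Suc j)) + (?B m (Suc j) + ?B m (Suc j))" for m
      by simp
    then have "geom_cone (Suc (Suc (m + Suc j))) (?A m (Suc j) + ?B m (Suc j))" for m
      using geom_cone.add[OF minus geom_cone.add[OF B B]] by metis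
    \<comment> \<open>For \<open>m = 0\<close> the combination in \<open>step\<close> is exactly the
      recursion of \<open>cont_poly\<close>.\<close>
    moreover have "geom_cone (Suc (Suc j)) (?q (Suc (Suc j)))"
      using step[of 0] by (simp add: geom_poly_Suc_0)
    ultimately show ?case
      using IH(1) minus by blast
  qed
  from this[of "k - 1"] assms show ?thesis
    by (cases k) auto
qed

lemma poly_cont_poly:
  assumes "\<And>i. i \<in> {1..k} \<Longrightarrow> \<epsilon> i \<in> {1, -1}" and "x \<noteq> 0"
  shows "poly (cont_poly (\<lambda>i. \<epsilon> (i + 1) * \<epsilon> (i + 2)) k) (x\<^sup>2) =
     (\<Prod>i = 1..k. \<epsilon> i) * (x ^ k * poly (s_poly \<epsilon> (Suc k)) (x + 1 / x))"
  using assms(1)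
proof (induction "\<lambda>i. \<epsilon> (i + 1) * \<epsilon> (i + 2)" k rule: cont_poly.induct)
  case 2
  then have "\<epsilon> 1 * \<epsilon> 1 = 1" by force
  then show ?case
    using assms(2) by (simp add: field_simps power2_eq_square)
next
  case (3 k)
  let ?P = "\<Prod>i = 1..k. \<epsilon> i" and ?a = "\<epsilon> (Suc k)" and ?b = "\<epsilon> (Suc (Suc k))"
  let ?s = "\<lambda>k. poly (s_poly \<epsilon> k) (x + 1 / x)"
  have sq: "?a * ?a = 1" "?b * ?b = 1"
    using "3.prems"[of "Suc k"] "3.prems"[of "Suc (Suc k)"] by auto
  have e: "1 + x\<^sup>2 = x * (x + 1 / x)"
    using assms(2) by (simp add: field_simps power2_eq_square)
  have "poly (cont_poly (\<lambda>i. \<epsilon> (i + 1) * \<epsilon> (i + 2)) (Suc (Suc k))) (x\<^sup>2)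
      = (1 + x\<^sup>2) * (?P * ?a * (x ^ Suc k * ?s (Suc (Suc k))))
        - ?a * ?b * (x\<^sup>2 * (?P * (x ^ k * ?s (Suc k))))"
    using "3.hyps" "3.prems" by (simp add: poly_monom algebra_simps del: s_poly.simps)
  \<comment> \<open>Inserting \<open>?b * ?b = 1\<close> lets the sign product
    \<open>?P * ?a * ?b\<close> factor out of both terms.\<close>
  also have "\<dots> = (?b * ?b) * (?P * ?a * (x ^ Suc (Suc k) * ((x + 1 / x) * ?s (Suc (Suc k)))))
        - ?a * ?b * (?P * (x ^ Suc (Suc k) * ?s (Suc k)))"
    unfolding e sq by (simp only: power_Suc power2_eq_square mult_1_left mult_ac)
  also have "\<dots> = ?P * ?a * ?b *
      (x ^ Suc (Suc k) * (?b * ((x + 1 / x) * ?s (Suc (Suc k))) - ?s (Suc k)))"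
    by (simp only: right_diff_distrib mult_ac)
  also have "\<dots> = (\<Prod>i = 1..Suc (Suc k). \<epsilon> i) * (x ^ Suc (Suc k) * ?s (Suc (Suc (Suc k))))"
    unfolding s_poly.simps(3)[of \<epsilon> "Suc k"] by (simp del: s_poly.simps)
  finally show ?case .
qed simp

theorem corollary7p4:
  fixes n :: nat and \<epsilon> :: "nat \<Rightarrow> real"
  assumes "n \<ge> 1" and "symmetric_signs n \<epsilon>"
  shows "unimodal (symmetrized_Riley n \<epsilon>)"
proof -
  define p where "p = cont_poly (\<lambda>i. \<epsilon> (i + 1) * \<epsilon> (i + 2)) (2 * n)"
  define \<sigma> where "\<sigma> = (\<Prod>i = 1..2 * n. \<epsilon> i)"
  have \<epsilon>: "\<epsilon> i \<in> {1, -1}" if "i \<in> {1..2 * n}" for i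
    using assms(2) that unfolding symmetric_signs_def by blast
  have "\<bar>\<sigma>\<bar> = 1"
    unfolding \<sigma>_def abs_prod using \<epsilon> by (intro prod.neutral) fastforce
  then have \<sigma>: "\<sigma> = 1 \<or> \<sigma> = -1"
    by linarith
  have "is_symmetrized_Riley n \<epsilon> (smult \<sigma> p)"
    unfolding is_symmetrized_Riley_def
  proof (intro allI impI)
    fix x :: real
    assume "x \<noteq> 0"
    have "poly p (x\<^sup>2) = \<sigma> * (x ^ (2 * n) * poly (s_poly \<epsilon> (2 * n + 1)) (x + 1 / x))"
      unfolding p_def \<sigma>_def Suc_eq_plus1[of "2 * n", symmetric]
      by (rule poly_cont_poly[OF \<epsilon> \<open>x \<noteq> 0\<close>])
    then show "poly (smult \<sigma> p) (x\<^sup>2)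
        = x ^ (2 * n) * poly (s_poly \<epsilon> (2 * n + 1)) (x + 1 / x)"
      using \<sigma> by auto
  qed
  then have "symmetrized_Riley n \<epsilon> = smult \<sigma> p"
    using ex1_symmetrized_Riley symmetrized_Riley by blast
  moreover have "\<epsilon> (i + 1) * \<epsilon> (i + 2) \<in> {1, -1}" if "Suc i < 2 * n" for i
    using \<epsilon>[of "i + 1"] \<epsilon>[of "i + 2"] that by auto
  then have "unimodal p"
    unfolding p_def by (rule unimodal_geom_cone[OF geom_cone_cont_poly])
  ultimately show ?thesis
    using \<sigma> unimodal_uminus by auto
qed

end
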